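(* Let $l \ge 1$, let $k_1,\dots,k_l$ be distinct natural numbers, and let $s_1,\dots,s_l$ be natural numbers. For a natural number $N$ let $R^+(N)$ denote the number of solutions of $$\sum_{i=1}^{l}\sum_{j=1}^{s_i} x_{ij}^{k_i} = \sum_{i=1}^{l}\sum_{j=1}^{s_i} y_{ij}^{k_i}$$ in natural numbers $x_{ij}, y_{ij}$ with $1 \le x_{ij}, y_{ij} \le N$, and for each $i$ let $R_{i}^+(N)$ denote the number of solutions of its homogeneous part $$\sum_{j=1}^{s_i} x_{ij}^{k_i} = \sum_{j=1}^{s_i} y_{ij}^{k_i}$$ in natural numbers $x_{ij}, y_{ij}$ with $1 \le x_{ij}, y_{ij} \le N$. Then $$R^+(N) \ge \prod_{i=1}^{l} R_{i}^+(N).$$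
   Context: Natural numbers are positive integers. *)

theory Defs
  imports Main "HOL-Library.FuncSet"
begin

text \<open>
  A family of natural numbers \<open>x i j\<close> with \<open>1 \<le> i \<le> l\<close>, \<open>1 \<le> j \<le> s i\<close> is an element of a
  (nested) extensional product, so that every such family is counted exactly once.
\<close>

definition R_plus :: "nat \<Rightarrow> (nat \<Rightarrow> nat) \<Rightarrow> (nat \<Rightarrow> nat) \<Rightarrow> nat \<Rightarrow> nat" where
  "R_plus l k s N =
     card {(x, y).
       x \<in> (\<Pi>\<^sub>E i\<in>{1..l}. \<Pi>\<^sub>E j\<in>{1..s i}. {1..N}) \<and>
       y \<in> (\<Pi>\<^sub>E i\<in>{1..l}. \<Pi>\<^sub>E j\<in>{1..s i}. {1..N}) \<and>
       (\<Sum>i=1..l. \<Sum>j=1..s i. x i j ^ k i) = (\<Sum>i=1..l. \<Sum>j=1..s i. y i j ^ k i)}"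

definition R_plus_part :: "(nat \<Rightarrow> nat) \<Rightarrow> (nat \<Rightarrow> nat) \<Rightarrow> nat \<Rightarrow> nat \<Rightarrow> nat" where
  "R_plus_part k s i N =
     card {(x, y).
       x \<in> (\<Pi>\<^sub>E j\<in>{1..s i}. {1..N}) \<and>
       y \<in> (\<Pi>\<^sub>E j\<in>{1..s i}. {1..N}) \<and>
       (\<Sum>j=1..s i. x j ^ k i) = (\<Sum>j=1..s i. y j ^ k i)}"

end

theory Submission
  imports Defs
begin

text \<open>Choose one solution of each homogeneous part. Adding the l chosen equations shows that
  together they solve the full equation, and every chosen part can be read off from the combined
  solution. So the product of the solution sets \<open>A i\<close> injects into the full solution
  set \<open>S\<close>.\<close>

theorem mainTheorem4:
  fixes l N :: nat and k s :: "nat \<Rightarrow> nat"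
  assumes "l \<ge> 1"
    and "\<And>i. i \<in> {1..l} \<Longrightarrow> k i \<ge> 1"
    and "inj_on k {1..l}"
    and "\<And>i. i \<in> {1..l} \<Longrightarrow> s i \<ge> 1"
    and "N \<ge> 1"
  shows "R_plus l k s N \<ge> (\<Prod>i=1..l. R_plus_part k s i N)"
proof -
  define B where "B i = (\<Pi>\<^sub>E j\<in>{1..s i}. {1..N})" for i
  define A where "A i = {(x, y). x \<in> B i \<and> y \<in> B i \<and>
    (\<Sum>j=1..s i. x j ^ k i) = (\<Sum>j=1..s i. y j ^ k i)}" for i
  define S where "S = {(x, y). x \<in> Pi\<^sub>E {1..l} B \<and> y \<in> Pi\<^sub>E {1..l} B \<and>
    (\<Sum>i=1..l. \<Sum>j=1..s i. x i j ^ k i) = (\<Sum>i=1..l. \<Sum>j=1..s i. y i j ^ k i)}"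
  \<comment> \<open>Turns a family of pairs into a pair of families; \<open>restrict\<close> makes
    both extensional, as membership in \<open>S\<close> demands.\<close>
  define glue :: "(nat \<Rightarrow> (nat \<Rightarrow> nat) \<times> (nat \<Rightarrow> nat)) \<Rightarrow> _"
    where "glue f = (restrict (fst \<circ> f) {1..l}, restrict (snd \<circ> f) {1..l})" for f
  \<comment> \<open>Finiteness matters: an infinite \<open>S\<close> would have
    \<open>card S = 0\<close>, and the injection would give no bound.\<close>
  have "finite (Pi\<^sub>E {1..l} B)"
    by (auto simp: B_def intro!: finite_PiE)
  moreover have "S \<subseteq> Pi\<^sub>E {1..l} B \<times> Pi\<^sub>E {1..l} B"
    by (auto simp: S_def)
  ultimately have "finite S"
    by (meson finite_SigmaI finite_subset)
  moreover have "inj_on glue (Pi\<^sub>E {1..l} A)"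
  proof (rule inj_onI)
    fix f g
    assume fg: "f \<in> Pi\<^sub>E {1..l} A" "g \<in> Pi\<^sub>E {1..l} A" and eq: "glue f = glue g"
    show "f = g"
    proof (rule PiE_ext[OF fg])
      fix i
      assume "i \<in> {1..l}"
      with eq show "f i = g i"
        unfolding glue_def prod.inject by (metis comp_apply prod_eqI restrict_apply')
    qed
  qed
  moreover have "glue ` Pi\<^sub>E {1..l} A \<subseteq> S"
  proof (rule image_subsetI)
    fix f
    assume "f \<in> Pi\<^sub>E {1..l} A"
    then have "f i \<in> A i" if "i \<in> {1..l}" for i
      using that by (rule PiE_mem)
    then have *: "fst (f i) \<in> B i" "snd (f i) \<in> B i"
      "(\<Sum>j=1..s i. fst (f i) j ^ k i) = (\<Sum>j=1..s i. snd (f i) j ^ k i)"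
      if "i \<in> {1..l}" for i
      using that by (auto simp: A_def case_prod_unfold)
    \<comment> \<open>The two double sums agree because their inner sums agree for each i.\<close>
    then show "glue f \<in> S"
      by (simp add: S_def glue_def PiE_iff)
  qed
  ultimately have "card (Pi\<^sub>E {1..l} A) \<le> card S"
    by (metis card_inj_on_le)
  then show ?thesis
    \<comment> \<open>\<open>card_PiE\<close> turns the left side into the product of the
      \<open>card (A i)\<close>. The form \<open>B_def[abs_def]\<close> is needed since
      \<open>B\<close> occurs unapplied in \<open>S\<close>.\<close>
    by (simp add: card_PiE R_plus_def R_plus_part_def S_def A_def B_def[abs_def])
qed

end
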